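(* Let $(\mathcal{C},\otimes,F,G,a,\Phi,d)$ be a hom-braided category. Then $d$ has the hom-Yang-Baxter property, that is, for all objects $U,V,W$ of $\mathcal{C}$ the following two morphisms $(U\otimes V)\otimes F(W)\to FG^2(W)\otimes(G^2(V)\otimes G^2(U))$ are equal: $$a_{G^2(W),G^2(V),G^2(U)}\circ(d_{G(V),G(W)}\otimes\mathrm{id}_{FG^2(U)})\circ a^{-1}_{G(V),G(W),G^2(U)}\circ(\mathrm{id}_{FG(V)}\otimes d_{G(U),W})\circ a_{G(V),G(U),W}\circ(d_{U,V}\otimes\mathrm{id}_{F(W)})$$ $$=(\mathrm{id}_{FG^2(W)}\otimes d_{G(U),G(V)})\circ a_{G^2(W),G(U),G(V)}\circ(d_{U,G(W)}\otimes\mathrm{id}_{FG(V)})\circ a^{-1}_{U,G(W),G(V)}\circ(\mathrm{id}_{F(U)}\otimes d_{V,W})\circ a_{U,V,W}.$$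
   Context: A hom-tensor category is a 6-tuple $(\mathcal{C},\otimes,F,G,a,\Phi)$ where: $\mathcal{C}$ is a category; $\otimes:\mathcal{C}\times\mathcal{C}\to\mathcal{C}$ is a functor; $F,G:\mathcal{C}\to\mathcal{C}$ are functors with $F(U\otimes V)=F(U)\otimes F(V)$, $F(f\otimes g)=F(f)\otimes F(g)$, and likewise $G(U\otimes V)=G(U)\otimes G(V)$, $G(f\otimes g)=G(f)\otimes G(g)$, for all objects $U,V$ and morphisms $f,g$; $FG=GF$; $a_{X,Y,Z}:(X\otimes Y)\otimes F(Z)\to F(X)\otimes(Y\otimes Z)$ is a natural isomorphism satisfying, for all objects $X,Y,Z,T$, $$a_{F(X),F(Y),Z\otimes T}\circ a_{X\otimes Y,F(Z),F(T)}=(\mathrm{id}_{F^2(X)}\otimes a_{Y,Z,T})\circ a_{F(X),Y\otimes Z,F(T)}\circ(a_{X,Y,Z}\otimes \mathrm{id}_{F^2(T)});$$ $\Phi:\mathrm{id}_{\mathcal{C}}\to G$ is a natural transformation with $F(\Phi_U)=\Phi_{F(U)}$, $G(\Phi_U)=\Phi_{G(U)}$ and $\Phi_{M\otimes N}=\Phi_M\otimes\Phi_N$ for all objects $U,M,N$. No unit object is required. A hom-braiding $d$ in a hom-tensor category is a family of morphisms $d_{V,W}:V\otimes W\to G(W)\otimes G(V)$, natural in $V,W$ (i.e. $(G(g)\otimes G(f))\circ d_{V,W}=d_{V',W'}\circ(f\otimes g)$ for all $f:V\to V'$, $g:W\to W'$), not required to be invertible, with $G(d_{U,V})=d_{G(U),G(V)}$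 for all $U,V$, and satisfying for all objects $U,V,W$: (H1) $(\mathrm{id}_{FG(V)}\otimes(\mathrm{id}_{G(W)}\otimes\Phi_{G(U)}))\circ a_{G(V),G(W),G(U)}\circ d_{F(U),V\otimes W}\circ a_{U,V,W}=(\mathrm{id}_{FG(V)}\otimes d_{G(U),W})\circ a_{G(V),G(U),W}\circ(d_{U,V}\otimes\mathrm{id}_{F(W)})$; (H2) $((\Phi_{G(W)}\otimes\mathrm{id}_{G(U)})\otimes\mathrm{id}_{FG(V)})\circ a^{-1}_{G(W),G(U),G(V)}\circ d_{U\otimes V,F(W)}\circ a^{-1}_{U,V,W}=(d_{U,G(W)}\otimes\mathrm{id}_{FG(V)})\circ a^{-1}_{U,G(W),G(V)}\circ(\mathrm{id}_{F(U)}\otimes d_{V,W})$. A hom-braided category $(\mathcal{C},\otimes,F,G,a,\Phi,d)$ is a hom-tensor category with a hom-braiding $d$. *)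

theory Defs
  imports Main
begin

section \<open>Categories, functors, natural transformations\<close>

text \<open>
  Objects and morphisms are elements of carrier sets \<open>Ob C\<close> and \<open>Arr C\<close>. All operations are total
  HOL functions, so axioms and equations are relativised to the carriers: values outside of them,
  in particular \<open>Comp C g f\<close> for \<open>Cod C f \<noteq> Dom C g\<close>, carry no meaning.
\<close>

record ('o, 'm) category_data =
  Ob :: "'o set"
  Arr :: "'m set"
  Dom :: "'m \<Rightarrow> 'o"
  Cod :: "'m \<Rightarrow> 'o"
  Ident :: "'o \<Rightarrow> 'm"
  Comp :: "'m \<Rightarrow> 'm \<Rightarrow> 'm"

definition hom :: "('o, 'm) category_data \<Rightarrow> 'o \<Rightarrow> 'o \<Rightarrow> 'm set" where
  "hom C X Y = {f \<in> Arr C. Dom C f = X \<and> Cod C f = Y}"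

locale category =
  fixes C :: "('o, 'm) category_data"
  assumes Dom_in_Ob: "f \<in> Arr C \<Longrightarrow> Dom C f \<in> Ob C"
    and Cod_in_Ob: "f \<in> Arr C \<Longrightarrow> Cod C f \<in> Ob C"
    and Ident_in_hom: "X \<in> Ob C \<Longrightarrow> Ident C X \<in> hom C X X"
    and Comp_in_hom: "\<lbrakk>f \<in> hom C X Y; g \<in> hom C Y Z\<rbrakk> \<Longrightarrow> Comp C g f \<in> hom C X Z"
    and Comp_Ident: "f \<in> hom C X Y \<Longrightarrow> Comp C f (Ident C X) = f"
    and Ident_Comp: "f \<in> hom C X Y \<Longrightarrow> Comp C (Ident C Y) f = f"
    and Comp_assoc: "\<lbrakk>f \<in> hom C X Y; g \<in> hom C Y Z; h \<in> hom C Z W\<rbrakk>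
      \<Longrightarrow> Comp C (Comp C h g) f = Comp C h (Comp C g f)"

definition inverse_arrows :: "('o, 'm) category_data \<Rightarrow> 'm \<Rightarrow> 'm \<Rightarrow> bool" where
  "inverse_arrows C f g \<longleftrightarrow> f \<in> Arr C \<and> g \<in> hom C (Cod C f) (Dom C f) \<and>
     Comp C g f = Ident C (Dom C f) \<and> Comp C f g = Ident C (Cod C f)"

definition is_iso :: "('o, 'm) category_data \<Rightarrow> 'm \<Rightarrow> bool" where
  "is_iso C f \<longleftrightarrow> (\<exists>g. inverse_arrows C f g)"

definition inverse_of :: "('o, 'm) category_data \<Rightarrow> 'm \<Rightarrow> 'm" where
  "inverse_of C f = (THE g. inverse_arrows C f g)"

definition product_category ::
  "('o1, 'm1) category_data \<Rightarrow> ('o2, 'm2) category_data \<Rightarrow> ('o1 \<times> 'o2, 'm1 \<times> 'm2) category_data" where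
  "product_category C D =
    \<lparr>Ob = Ob C \<times> Ob D,
     Arr = Arr C \<times> Arr D,
     Dom = (\<lambda>(f, g). (Dom C f, Dom D g)),
     Cod = (\<lambda>(f, g). (Cod C f, Cod D g)),
     Ident = (\<lambda>(X, Y). (Ident C X, Ident D Y)),
     Comp = (\<lambda>(f', g') (f, g). (Comp C f' f, Comp D g' g))\<rparr>"

record ('o1, 'm1, 'o2, 'm2) functor_data =
  ob_map :: "'o1 \<Rightarrow> 'o2"
  arr_map :: "'m1 \<Rightarrow> 'm2"

locale category_functor = source: category C + target: category D
  for C :: "('o1, 'm1) category_data"
    and D :: "('o2, 'm2) category_data" +
  fixes F :: "('o1, 'm1, 'o2, 'm2) functor_data"
  assumes ob_map_in_Ob: "X \<in> Ob C \<Longrightarrow> ob_map F X \<in> Ob D"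
    and arr_map_in_hom: "f \<in> hom C X Y \<Longrightarrow> arr_map F f \<in> hom D (ob_map F X) (ob_map F Y)"
    and arr_map_Ident: "X \<in> Ob C \<Longrightarrow> arr_map F (Ident C X) = Ident D (ob_map F X)"
    and arr_map_Comp: "\<lbrakk>f \<in> hom C X Y; g \<in> hom C Y Z\<rbrakk>
      \<Longrightarrow> arr_map F (Comp C g f) = Comp D (arr_map F g) (arr_map F f)"

definition identity_functor :: "('o, 'm, 'o, 'm) functor_data" where
  "identity_functor = \<lparr>ob_map = (\<lambda>X. X), arr_map = (\<lambda>f. f)\<rparr>"

locale natural_transformation =
  dom_functor: category_functor C D F + cod_functor: category_functor C D G
  for C :: "('o1, 'm1) category_data"
    and D :: "('o2, 'm2) category_data"
    and F G :: "('o1, 'm1, 'o2, 'm2) functor_data" +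
  fixes \<tau> :: "'o1 \<Rightarrow> 'm2"
  assumes component_in_hom: "X \<in> Ob C \<Longrightarrow> \<tau> X \<in> hom D (ob_map F X) (ob_map G X)"
    and naturality: "f \<in> hom C X Y
      \<Longrightarrow> Comp D (\<tau> Y) (arr_map F f) = Comp D (arr_map G f) (\<tau> X)"

locale natural_isomorphism = natural_transformation C D F G \<tau>
  for C :: "('o1, 'm1) category_data"
    and D :: "('o2, 'm2) category_data"
    and F G :: "('o1, 'm1, 'o2, 'm2) functor_data"
    and \<tau> :: "'o1 \<Rightarrow> 'm2" +
  assumes component_is_iso: "X \<in> Ob C \<Longrightarrow> is_iso D (\<tau> X)"


section \<open>Hom-tensor categories\<close>

locale hom_tensor_data =
  fixes C :: "('o, 'm) category_data"
    and T :: "('o \<times> 'o, 'm \<times> 'm, 'o, 'm) functor_data"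
    and F G :: "('o, 'm, 'o, 'm) functor_data"
    and a :: "'o \<Rightarrow> 'o \<Rightarrow> 'o \<Rightarrow> 'm"
    and \<Phi> :: "'o \<Rightarrow> 'm"
begin

abbreviation comp (infixr "\<cdot>" 55) where "g \<cdot> f \<equiv> Comp C g f"
abbreviation ident where "ident X \<equiv> Ident C X"
abbreviation tensor_ob (infixr "\<otimes>\<^sub>o" 70) where "X \<otimes>\<^sub>o Y \<equiv> ob_map T (X, Y)"
abbreviation tensor_arr (infixr "\<otimes>" 70) where "f \<otimes> g \<equiv> arr_map T (f, g)"
abbreviation Fo where "Fo X \<equiv> ob_map F X"
abbreviation Fm where "Fm f \<equiv> arr_map F f"
abbreviation Go where "Go X \<equiv> ob_map G X"
abbreviation Gm where "Gm f \<equiv> arr_map G f"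
abbreviation a_inv where "a_inv X Y Z \<equiv> inverse_of C (a X Y Z)"

definition left_bracketing :: "(('o \<times> 'o) \<times> 'o, ('m \<times> 'm) \<times> 'm, 'o, 'm) functor_data" where
  "left_bracketing =
    \<lparr>ob_map = (\<lambda>((X, Y), Z). (X \<otimes>\<^sub>o Y) \<otimes>\<^sub>o Fo Z),
     arr_map = (\<lambda>((f, g), h). (f \<otimes> g) \<otimes> Fm h)\<rparr>"

definition right_bracketing :: "(('o \<times> 'o) \<times> 'o, ('m \<times> 'm) \<times> 'm, 'o, 'm) functor_data" where
  "right_bracketing =
    \<lparr>ob_map = (\<lambda>((X, Y), Z). Fo X \<otimes>\<^sub>o (Y \<otimes>\<^sub>o Z)),
     arr_map = (\<lambda>((f, g), h). Fm f \<otimes> (g \<otimes> h))\<rparr>"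

end

locale hom_tensor_category = hom_tensor_data C T F G a \<Phi>
  for C :: "('o, 'm) category_data"
    and T :: "('o \<times> 'o, 'm \<times> 'm, 'o, 'm) functor_data"
    and F G :: "('o, 'm, 'o, 'm) functor_data"
    and a :: "'o \<Rightarrow> 'o \<Rightarrow> 'o \<Rightarrow> 'm"
    and \<Phi> :: "'o \<Rightarrow> 'm" +
  assumes category_C: "category C"
    and functor_T: "category_functor (product_category C C) C T"
    and functor_F: "category_functor C C F"
    and functor_G: "category_functor C C G"
    and F_tensor_ob: "\<lbrakk>U \<in> Ob C; V \<in> Ob C\<rbrakk> \<Longrightarrow> Fo (U \<otimes>\<^sub>o V) = Fo U \<otimes>\<^sub>o Fo V"
    and F_tensor_arr: "\<lbrakk>f \<in> Arr C; g \<in> Arr C\<rbrakk> \<Longrightarrow> Fm (f \<otimes> g) = Fm f \<otimes> Fm g"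
    and G_tensor_ob: "\<lbrakk>U \<in> Ob C; V \<in> Ob C\<rbrakk> \<Longrightarrow> Go (U \<otimes>\<^sub>o V) = Go U \<otimes>\<^sub>o Go V"
    and G_tensor_arr: "\<lbrakk>f \<in> Arr C; g \<in> Arr C\<rbrakk> \<Longrightarrow> Gm (f \<otimes> g) = Gm f \<otimes> Gm g"
    and F_G_ob: "U \<in> Ob C \<Longrightarrow> Fo (Go U) = Go (Fo U)"
    and F_G_arr: "f \<in> Arr C \<Longrightarrow> Fm (Gm f) = Gm (Fm f)"
    and a_natural_iso:
      "natural_isomorphism (product_category (product_category C C) C) C
         left_bracketing right_bracketing (\<lambda>((X, Y), Z). a X Y Z)"
    and hom_pentagon:
      "\<lbrakk>X \<in> Ob C; Y \<in> Ob C; Z \<in> Ob C; T' \<in> Ob C\<rbrakk> \<Longrightarrow>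
         a (Fo X) (Fo Y) (Z \<otimes>\<^sub>o T') \<cdot> a (X \<otimes>\<^sub>o Y) (Fo Z) (Fo T') =
         (ident (Fo (Fo X)) \<otimes> a Y Z T') \<cdot> a (Fo X) (Y \<otimes>\<^sub>o Z) (Fo T')
           \<cdot> (a X Y Z \<otimes> ident (Fo (Fo T')))"
    and \<Phi>_natural: "natural_transformation C C identity_functor G \<Phi>"
    and F_\<Phi>: "U \<in> Ob C \<Longrightarrow> Fm (\<Phi> U) = \<Phi> (Fo U)"
    and G_\<Phi>: "U \<in> Ob C \<Longrightarrow> Gm (\<Phi> U) = \<Phi> (Go U)"
    and \<Phi>_tensor: "\<lbrakk>M \<in> Ob C; N \<in> Ob C\<rbrakk> \<Longrightarrow> \<Phi> (M \<otimes>\<^sub>o N) = \<Phi> M \<otimes> \<Phi> N"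


section \<open>Hom-braidings\<close>

locale hom_braiding_data = hom_tensor_data C T F G a \<Phi>
  for C :: "('o, 'm) category_data"
    and T :: "('o \<times> 'o, 'm \<times> 'm, 'o, 'm) functor_data"
    and F G :: "('o, 'm, 'o, 'm) functor_data"
    and a :: "'o \<Rightarrow> 'o \<Rightarrow> 'o \<Rightarrow> 'm"
    and \<Phi> :: "'o \<Rightarrow> 'm" +
  fixes d :: "'o \<Rightarrow> 'o \<Rightarrow> 'm"
begin

definition yang_baxter_left :: "'o \<Rightarrow> 'o \<Rightarrow> 'o \<Rightarrow> 'm" where
  "yang_baxter_left U V W =
     a (Go (Go W)) (Go (Go V)) (Go (Go U))
       \<cdot> (d (Go V) (Go W) \<otimes> ident (Fo (Go (Go U))))
       \<cdot> a_inv (Go V) (Go W) (Go (Go U))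
       \<cdot> (ident (Fo (Go V)) \<otimes> d (Go U) W)
       \<cdot> a (Go V) (Go U) W
       \<cdot> (d U V \<otimes> ident (Fo W))"

definition yang_baxter_right :: "'o \<Rightarrow> 'o \<Rightarrow> 'o \<Rightarrow> 'm" where
  "yang_baxter_right U V W =
     (ident (Fo (Go (Go W))) \<otimes> d (Go U) (Go V))
       \<cdot> a (Go (Go W)) (Go U) (Go V)
       \<cdot> (d U (Go W) \<otimes> ident (Fo (Go V)))
       \<cdot> a_inv U (Go W) (Go V)
       \<cdot> (ident (Fo U) \<otimes> d V W)
       \<cdot> a U V W"

text \<open>
  Since \<open>Comp\<close> is total, the equality is accompanied by the statement that both sides are
  morphisms with the expected domain and codomain.
\<close>

definition hom_Yang_Baxter :: bool where
  "hom_Yang_Baxter \<longleftrightarrow>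
    (\<forall>U \<in> Ob C. \<forall>V \<in> Ob C. \<forall>W \<in> Ob C.
       yang_baxter_left U V W \<in>
         hom C ((U \<otimes>\<^sub>o V) \<otimes>\<^sub>o Fo W) (Fo (Go (Go W)) \<otimes>\<^sub>o (Go (Go V) \<otimes>\<^sub>o Go (Go U))) \<and>
       yang_baxter_right U V W \<in>
         hom C ((U \<otimes>\<^sub>o V) \<otimes>\<^sub>o Fo W) (Fo (Go (Go W)) \<otimes>\<^sub>o (Go (Go V) \<otimes>\<^sub>o Go (Go U))) \<and>
       yang_baxter_left U V W = yang_baxter_right U V W)"

end

locale hom_braided_category =
  hom_tensor_category C T F G a \<Phi> + hom_braiding_data C T F G a \<Phi> d
  for C :: "('o, 'm) category_data"
    and T :: "('o \<times> 'o, 'm \<times> 'm, 'o, 'm) functor_data"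
    and F G :: "('o, 'm, 'o, 'm) functor_data"
    and a :: "'o \<Rightarrow> 'o \<Rightarrow> 'o \<Rightarrow> 'm"
    and \<Phi> :: "'o \<Rightarrow> 'm"
    and d :: "'o \<Rightarrow> 'o \<Rightarrow> 'm" +
  assumes d_in_hom:
      "\<lbrakk>V \<in> Ob C; W \<in> Ob C\<rbrakk> \<Longrightarrow> d V W \<in> hom C (V \<otimes>\<^sub>o W) (Go W \<otimes>\<^sub>o Go V)"
    and d_natural:
      "\<lbrakk>f \<in> hom C V V'; g \<in> hom C W W'\<rbrakk>
        \<Longrightarrow> (Gm g \<otimes> Gm f) \<cdot> d V W = d V' W' \<cdot> (f \<otimes> g)"
    and G_d: "\<lbrakk>U \<in> Ob C; V \<in> Ob C\<rbrakk> \<Longrightarrow> Gm (d U V) = d (Go U) (Go V)"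
    and H1:
      "\<lbrakk>U \<in> Ob C; V \<in> Ob C; W \<in> Ob C\<rbrakk> \<Longrightarrow>
         (ident (Fo (Go V)) \<otimes> (ident (Go W) \<otimes> \<Phi> (Go U)))
           \<cdot> a (Go V) (Go W) (Go U) \<cdot> d (Fo U) (V \<otimes>\<^sub>o W) \<cdot> a U V W =
         (ident (Fo (Go V)) \<otimes> d (Go U) W) \<cdot> a (Go V) (Go U) W \<cdot> (d U V \<otimes> ident (Fo W))"
    and H2:
      "\<lbrakk>U \<in> Ob C; V \<in> Ob C; W \<in> Ob C\<rbrakk> \<Longrightarrow>
         ((\<Phi> (Go W) \<otimes> ident (Go U)) \<otimes> ident (Fo (Go V)))
           \<cdot> a_inv (Go W) (Go U) (Go V) \<cdot> d (U \<otimes>\<^sub>o V) (Fo W) \<cdot> a_inv U V W =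
         (d U (Go W) \<otimes> ident (Fo (Go V))) \<cdot> a_inv U (Go W) (Go V) \<cdot> (ident (Fo U) \<otimes> d V W)"

end

theory Submission
  imports Defs
begin

text \<open>
  Both sides of the hom-Yang-Baxter equation contain an instance of the right-hand side of the
  first hexagon axiom (H1): the left one as the three factors that are applied first, at
  \<open>(U, V, W)\<close>, the right one as the three that are applied last, at \<open>(U, G W, G V)\<close>. Rewriting
  both instances with (H1), in the form \<open>H1_\<Phi>_inside\<close>, replaces two successive braidings past
  single objects by one braiding of \<open>F U\<close> past their tensor product.
  What remains is to compare ``braid \<open>F U\<close> past \<open>V \<otimes> W\<close>, then exchange \<open>G V\<close> and \<open>G W\<close>'' with
  ``exchange \<open>V\<close> and \<open>W\<close>, then braid \<open>F U\<close> past \<open>G W \<otimes> G V\<close>''. Since \<open>d (G V) (G W) = G (d V W)\<close>,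
  this is naturality of the braiding in its second argument, applied to the morphism \<open>d V W\<close>;
  see \<open>braiding_past_exchange\<close>.
  The extra factors \<open>\<Phi>\<close> that (H1) introduces act on the strand of \<open>U\<close> only: they move through the
  associator by its naturality and commute with the exchange of the other two strands by
  functoriality of the tensor product.

  All composites are kept in right-nested form. For that purpose typing of morphisms is recast as
  membership in \<open>Arr C\<close> together with equations for \<open>Dom\<close> and \<open>Cod\<close>, which the simplifier can use
  to discharge the side conditions of associativity.
\<close>

section \<open>Typing of morphisms by domain and codomain equations\<close>

context category
begin

lemma hom_iff: "f \<in> hom C X Y \<longleftrightarrow> f \<in> Arr C \<and> Dom C f = X \<and> Cod C f = Y"
  by (simp add: hom_def)

lemma Ident_typing [simp]:
  assumes "X \<in> Ob C"
  shows "Ident C X \<in> Arr C" "Dom C (Ident C X) = X" "Cod C (Ident C X) = X"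
  using Ident_in_hom[OF assms] by (simp_all add: hom_iff)

lemma Comp_typing [simp]:
  assumes "f \<in> Arr C" "g \<in> Arr C" "Dom C g = Cod C f"
  shows "Comp C g f \<in> Arr C" "Dom C (Comp C g f) = Dom C f" "Cod C (Comp C g f) = Cod C g"
  using Comp_in_hom[of f "Dom C f" "Cod C f" g "Cod C g"] assms by (simp_all add: hom_iff)

lemma Comp_Ident_simp [simp]:
  assumes "f \<in> Arr C" "Dom C f = X"
  shows "Comp C f (Ident C X) = f"
  using assms Comp_Ident[of f X "Cod C f"] by (simp add: hom_iff)

lemma Ident_Comp_simp [simp]:
  assumes "f \<in> Arr C" "Cod C f = X"
  shows "Comp C (Ident C X) f = f"
  using assms Ident_Comp[of f "Dom C f" X] by (simp add: hom_iff)

lemma Comp_assoc_simp [simp]: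
  assumes "f \<in> Arr C" "g \<in> Arr C" "h \<in> Arr C" "Dom C g = Cod C f" "Dom C h = Cod C g"
  shows "Comp C (Comp C h g) f = Comp C h (Comp C g f)"
  using assms Comp_assoc[of f "Dom C f" "Cod C f" g "Cod C g" h "Cod C h"] by (simp add: hom_iff)

lemma inverse_arrows_unique:
  assumes "inverse_arrows C f g" "inverse_arrows C f h"
  shows "g = h"
proof -
  have typing: "f \<in> Arr C" "g \<in> Arr C" "h \<in> Arr C" "Dom C g = Cod C f" "Cod C g = Dom C f"
    "Dom C h = Cod C f" "Cod C h = Dom C f"
    using assms by (auto simp: inverse_arrows_def hom_iff)
  have "g = Comp C g (Comp C f h)"
    using assms(2) typing by (simp add: inverse_arrows_def)
  also have "\<dots> = Comp C (Comp C g f) h"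
    using typing by simp
  also have "\<dots> = h"
    using assms(1) typing by (simp add: inverse_arrows_def)
  finally show ?thesis .
qed

lemma inverse_arrows_inverse_of: "is_iso C f \<Longrightarrow> inverse_arrows C f (inverse_of C f)"
  unfolding is_iso_def inverse_of_def by (blast intro: theI inverse_arrows_unique)

end

context category_functor
begin

lemma arr_map_typing:
  assumes "f \<in> Arr C"
  shows "arr_map F f \<in> Arr D" "Dom D (arr_map F f) = ob_map F (Dom C f)"
    "Cod D (arr_map F f) = ob_map F (Cod C f)"
  using arr_map_in_hom[of f "Dom C f" "Cod C f"] assms
  by (simp_all add: source.hom_iff target.hom_iff)

end

section \<open>Structure morphisms of a hom-tensor category\<close>

context hom_tensor_category
begin

sublocale category C
  by (rule category_C)

sublocale F: category_functor C C F
  by (rule functor_F)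

sublocale G: category_functor C C G
  by (rule functor_G)

declare F.ob_map_in_Ob [simp] F.arr_map_typing [simp] F.arr_map_Ident [simp]
declare G.ob_map_in_Ob [simp] G.arr_map_typing [simp] G.arr_map_Ident [simp]
declare G_tensor_ob [simp] F_G_ob [simp]

lemma tensor_ob_in_Ob [simp]: "\<lbrakk>X \<in> Ob C; Y \<in> Ob C\<rbrakk> \<Longrightarrow> X \<otimes>\<^sub>o Y \<in> Ob C"
  using category_functor.ob_map_in_Ob[OF functor_T, of "(X, Y)"]
  by (simp add: product_category_def)

lemma tensor_arr_typing [simp]:
  assumes "f \<in> Arr C" "g \<in> Arr C"
  shows "f \<otimes> g \<in> Arr C" "Dom C (f \<otimes> g) = Dom C f \<otimes>\<^sub>o Dom C g"
    "Cod C (f \<otimes> g) = Cod C f \<otimes>\<^sub>o Cod C g"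
  using category_functor.arr_map_typing[OF functor_T, of "(f, g)"] assms
  by (simp_all add: product_category_def)

lemma tensor_ident: "\<lbrakk>X \<in> Ob C; Y \<in> Ob C\<rbrakk> \<Longrightarrow> ident X \<otimes> ident Y = ident (X \<otimes>\<^sub>o Y)"
  using category_functor.arr_map_Ident[OF functor_T, of "(X, Y)"]
  by (simp add: product_category_def)

lemma tensor_interchange:
  assumes "f \<in> Arr C" "f' \<in> Arr C" "g \<in> Arr C" "g' \<in> Arr C"
    and "Dom C f' = Cod C f" "Dom C g' = Cod C g"
  shows "(f' \<otimes> g') \<cdot> (f \<otimes> g) = (f' \<cdot> f) \<otimes> (g' \<cdot> g)"
  using category_functor.arr_map_Comp[OF functor_T, of "(f, g)" "(Dom C f, Dom C g)"
      "(Cod C f, Cod C g)" "(f', g')" "(Cod C f', Cod C g')"] assms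
  by (simp add: product_category_def hom_def)

lemma a_inverse_arrows:
  assumes "X \<in> Ob C" "Y \<in> Ob C" "Z \<in> Ob C"
  shows "inverse_arrows C (a X Y Z) (a_inv X Y Z)"
  using natural_isomorphism.component_is_iso[OF a_natural_iso, of "((X, Y), Z)"] assms
  by (simp add: product_category_def inverse_arrows_inverse_of)

lemma a_typing [simp]:
  assumes "X \<in> Ob C" "Y \<in> Ob C" "Z \<in> Ob C"
  shows "a X Y Z \<in> Arr C" "Dom C (a X Y Z) = (X \<otimes>\<^sub>o Y) \<otimes>\<^sub>o Fo Z"
    "Cod C (a X Y Z) = Fo X \<otimes>\<^sub>o (Y \<otimes>\<^sub>o Z)"
  using natural_transformation.component_in_hom
      [OF natural_isomorphism.axioms(1)[OF a_natural_iso], of "((X, Y), Z)"] assms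
  by (simp_all add: product_category_def left_bracketing_def right_bracketing_def hom_def)

lemma a_inv_typing [simp]:
  assumes "X \<in> Ob C" "Y \<in> Ob C" "Z \<in> Ob C"
  shows "a_inv X Y Z \<in> Arr C" "Dom C (a_inv X Y Z) = Fo X \<otimes>\<^sub>o (Y \<otimes>\<^sub>o Z)"
    "Cod C (a_inv X Y Z) = (X \<otimes>\<^sub>o Y) \<otimes>\<^sub>o Fo Z"
  using a_inverse_arrows[OF assms] assms by (simp_all add: inverse_arrows_def hom_def)

lemma a_inv_a:
  assumes "X \<in> Ob C" "Y \<in> Ob C" "Z \<in> Ob C"
  shows "a_inv X Y Z \<cdot> a X Y Z = ident ((X \<otimes>\<^sub>o Y) \<otimes>\<^sub>o Fo Z)"
  using a_inverse_arrows[OF assms] assms by (simp add: inverse_arrows_def)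

lemma a_a_inv:
  assumes "X \<in> Ob C" "Y \<in> Ob C" "Z \<in> Ob C"
  shows "a X Y Z \<cdot> a_inv X Y Z = ident (Fo X \<otimes>\<^sub>o (Y \<otimes>\<^sub>o Z))"
  using a_inverse_arrows[OF assms] assms by (simp add: inverse_arrows_def)

lemma a_naturality:
  assumes "f \<in> Arr C" "g \<in> Arr C" "h \<in> Arr C"
  shows "a (Cod C f) (Cod C g) (Cod C h) \<cdot> ((f \<otimes> g) \<otimes> Fm h) =
    (Fm f \<otimes> (g \<otimes> h)) \<cdot> a (Dom C f) (Dom C g) (Dom C h)"
  using natural_transformation.naturality
      [OF natural_isomorphism.axioms(1)[OF a_natural_iso], of "((f, g), h)"
        "((Dom C f, Dom C g), Dom C h)" "((Cod C f, Cod C g), Cod C h)"] assms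
  by (simp add: product_category_def left_bracketing_def right_bracketing_def hom_def)

lemma \<Phi>_typing [simp]:
  assumes "X \<in> Ob C"
  shows "\<Phi> X \<in> Arr C" "Dom C (\<Phi> X) = X" "Cod C (\<Phi> X) = Go X"
  using natural_transformation.component_in_hom[OF \<Phi>_natural assms]
  by (simp_all add: hom_def identity_functor_def)

text \<open>
  Naturality of the associator at \<open>\<Phi>\<close> in the third argument, where the compatibility
  \<open>F (\<Phi> Z) = \<Phi> (F Z)\<close> turns the image under \<open>F\<close> into a component of \<open>\<Phi>\<close> again.
\<close>

lemma a_\<Phi>_third:
  assumes "X \<in> Ob C" "Y \<in> Ob C" "Z \<in> Ob C"
  shows "(ident (Fo X) \<otimes> (ident Y \<otimes> \<Phi> Z)) \<cdot> a X Y Z =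
    a X Y (Go Z) \<cdot> (ident (X \<otimes>\<^sub>o Y) \<otimes> \<Phi> (Fo Z))"
  using a_naturality[of "ident X" "ident Y" "\<Phi> Z"] assms by (simp add: tensor_ident F_\<Phi>)

end

section \<open>The hom-Yang-Baxter equation\<close>

context hom_braided_category
begin

lemma d_typing [simp]:
  assumes "V \<in> Ob C" "W \<in> Ob C"
  shows "d V W \<in> Arr C" "Dom C (d V W) = V \<otimes>\<^sub>o W" "Cod C (d V W) = Go W \<otimes>\<^sub>o Go V"
  using d_in_hom[OF assms] by (simp_all add: hom_iff)

text \<open>
  Braiding an object \<open>X\<close> past \<open>V \<otimes> W\<close> and then exchanging \<open>G V\<close> with \<open>G W\<close> amounts to exchanging
  \<open>V\<close> with \<open>W\<close> first: naturality of the braiding applied to \<open>d V W\<close>, with the exchange on the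
  left-hand side recognised as \<open>G (d V W)\<close>. The morphism \<open>\<Phi>\<close> on the strand of \<open>X\<close> is slid past the
  exchange by the interchange law.
\<close>

lemma braiding_past_exchange:
  assumes [simp]: "X \<in> Ob C" "V \<in> Ob C" "W \<in> Ob C"
  shows "(d (Go V) (Go W) \<otimes> ident (Go (Go X))) \<cdot> (ident (Go V \<otimes>\<^sub>o Go W) \<otimes> \<Phi> (Go X)) \<cdot> d X (V \<otimes>\<^sub>o W) =
    (ident (Go (Go W) \<otimes>\<^sub>o Go (Go V)) \<otimes> \<Phi> (Go X)) \<cdot> d X (Go W \<otimes>\<^sub>o Go V) \<cdot> (ident X \<otimes> d V W)"
    (is "?lhs = ?rhs")
proof -
  have slide: "(d (Go V) (Go W) \<otimes> ident (Go (Go X))) \<cdot> (ident (Go V \<otimes>\<^sub>o Go W) \<otimes> \<Phi> (Go X)) =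
      (ident (Go (Go W) \<otimes>\<^sub>o Go (Go V)) \<otimes> \<Phi> (Go X)) \<cdot> (d (Go V) (Go W) \<otimes> ident (Go X))"
    by (simp add: tensor_interchange)
  have natural: "(d (Go V) (Go W) \<otimes> ident (Go X)) \<cdot> d X (V \<otimes>\<^sub>o W) =
      d X (Go W \<otimes>\<^sub>o Go V) \<cdot> (ident X \<otimes> d V W)"
    using d_natural[of "ident X" X X "d V W" "V \<otimes>\<^sub>o W" "Go W \<otimes>\<^sub>o Go V"]
    by (simp add: hom_iff G_d)
  have "?lhs = ((d (Go V) (Go W) \<otimes> ident (Go (Go X))) \<cdot> (ident (Go V \<otimes>\<^sub>o Go W) \<otimes> \<Phi> (Go X)))
      \<cdot> d X (V \<otimes>\<^sub>o W)"
    by simp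
  also have "\<dots> = (ident (Go (Go W) \<otimes>\<^sub>o Go (Go V)) \<otimes> \<Phi> (Go X))
      \<cdot> (d (Go V) (Go W) \<otimes> ident (Go X)) \<cdot> d X (V \<otimes>\<^sub>o W)"
    unfolding slide by simp
  finally show ?thesis
    unfolding natural .
qed

text \<open>
  The common value of both sides: exchange \<open>V\<close> and \<open>W\<close>, then braid \<open>F U\<close> past the result in a
  single step.
\<close>

definition exchange_then_braid :: "'o \<Rightarrow> 'o \<Rightarrow> 'o \<Rightarrow> 'm" where
  "exchange_then_braid U V W =
     a (Go (Go W)) (Go (Go V)) (Go (Go U))
       \<cdot> (ident (Go (Go W) \<otimes>\<^sub>o Go (Go V)) \<otimes> \<Phi> (Fo (Go U)))
       \<cdot> d (Fo U) (Go W \<otimes>\<^sub>o Go V)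
       \<cdot> (ident (Fo U) \<otimes> d V W)
       \<cdot> a U V W"

text \<open>
  (H1) with its morphism \<open>\<Phi>\<close> moved to the right of the associator. There it no longer separates the
  associator from the inverse associator that follows in the left-hand side of the hom-Yang-Baxter
  equation, so that these two cancel.
\<close>

lemma H1_\<Phi>_inside:
  assumes [simp]: "U \<in> Ob C" "V \<in> Ob C" "W \<in> Ob C"
  shows "(ident (Fo (Go V)) \<otimes> d (Go U) W) \<cdot> a (Go V) (Go U) W \<cdot> (d U V \<otimes> ident (Fo W)) =
    a (Go V) (Go W) (Go (Go U)) \<cdot> (ident (Go V \<otimes>\<^sub>o Go W) \<otimes> \<Phi> (Fo (Go U)))
      \<cdot> d (Fo U) (V \<otimes>\<^sub>o W) \<cdot> a U V W"
    (is "?lhs = ?rhs")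
proof -
  have "?lhs = ((ident (Fo (Go V)) \<otimes> (ident (Go W) \<otimes> \<Phi> (Go U))) \<cdot> a (Go V) (Go W) (Go U))
      \<cdot> d (Fo U) (V \<otimes>\<^sub>o W) \<cdot> a U V W"
    using H1[of U V W] by simp
  also have "\<dots> = ?rhs"
    by (subst a_\<Phi>_third) simp_all
  finally show ?thesis .
qed

lemma yang_baxter_left_eq:
  assumes [simp]: "U \<in> Ob C" "V \<in> Ob C" "W \<in> Ob C"
  shows "yang_baxter_left U V W = exchange_then_braid U V W"
proof -
  let ?a = "a (Go (Go W)) (Go (Go V)) (Go (Go U))"
  let ?dG = "d (Go V) (Go W) \<otimes> ident (Fo (Go (Go U)))"
  let ?\<Phi> = "ident (Go V \<otimes>\<^sub>o Go W) \<otimes> \<Phi> (Fo (Go U))"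
  have "yang_baxter_left U V W = ?a \<cdot> ?dG \<cdot> a_inv (Go V) (Go W) (Go (Go U))
      \<cdot> a (Go V) (Go W) (Go (Go U)) \<cdot> ?\<Phi> \<cdot> d (Fo U) (V \<otimes>\<^sub>o W) \<cdot> a U V W"
    unfolding yang_baxter_left_def by (subst H1_\<Phi>_inside) simp_all
  also have "\<dots> = ?a \<cdot> ?dG \<cdot> (a_inv (Go V) (Go W) (Go (Go U)) \<cdot> a (Go V) (Go W) (Go (Go U)))
      \<cdot> ?\<Phi> \<cdot> d (Fo U) (V \<otimes>\<^sub>o W) \<cdot> a U V W"
    by simp
  also have "\<dots> = ?a \<cdot> (?dG \<cdot> ?\<Phi> \<cdot> d (Fo U) (V \<otimes>\<^sub>o W)) \<cdot> a U V W"
    by (subst a_inv_a) simp_all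
  also have "?dG \<cdot> ?\<Phi> \<cdot> d (Fo U) (V \<otimes>\<^sub>o W) =
      (ident (Go (Go W) \<otimes>\<^sub>o Go (Go V)) \<otimes> \<Phi> (Fo (Go U))) \<cdot> d (Fo U) (Go W \<otimes>\<^sub>o Go V)
        \<cdot> (ident (Fo U) \<otimes> d V W)"
    using braiding_past_exchange[of "Fo U" V W] by simp
  finally show ?thesis
    unfolding exchange_then_braid_def by simp
qed

lemma yang_baxter_right_eq:
  assumes [simp]: "U \<in> Ob C" "V \<in> Ob C" "W \<in> Ob C"
  shows "yang_baxter_right U V W = exchange_then_braid U V W"
proof -
  let ?tail = "(ident (Fo U) \<otimes> d V W) \<cdot> a U V W"
  let ?braid = "a (Go (Go W)) (Go (Go V)) (Go (Go U))
      \<cdot> (ident (Go (Go W) \<otimes>\<^sub>o Go (Go V)) \<otimes> \<Phi> (Fo (Go U))) \<cdot> d (Fo U) (Go W \<otimes>\<^sub>o Go V)"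
  have "yang_baxter_right U V W =
      ((ident (Fo (Go (Go W))) \<otimes> d (Go U) (Go V)) \<cdot> a (Go (Go W)) (Go U) (Go V)
        \<cdot> (d U (Go W) \<otimes> ident (Fo (Go V)))) \<cdot> a_inv U (Go W) (Go V) \<cdot> ?tail"
    unfolding yang_baxter_right_def by simp
  also have "\<dots> = ?braid \<cdot> (a U (Go W) (Go V) \<cdot> a_inv U (Go W) (Go V)) \<cdot> ?tail"
    by (subst H1_\<Phi>_inside) simp_all
  also have "\<dots> = ?braid \<cdot> ?tail"
    by (subst a_a_inv) simp_all
  finally show ?thesis
    unfolding exchange_then_braid_def by simp
qed

lemma exchange_then_braid_in_hom:
  assumes "U \<in> Ob C" "V \<in> Ob C" "W \<in> Ob C"
  shows "exchange_then_braid U V W \<in>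
    hom C ((U \<otimes>\<^sub>o V) \<otimes>\<^sub>o Fo W) (Fo (Go (Go W)) \<otimes>\<^sub>o (Go (Go V) \<otimes>\<^sub>o Go (Go U)))"
  using assms by (simp add: exchange_then_braid_def hom_iff)

end

theorem proposition6p4:
  fixes C :: "('o, 'm) category_data"
    and T :: "('o \<times> 'o, 'm \<times> 'm, 'o, 'm) functor_data"
    and F G :: "('o, 'm, 'o, 'm) functor_data"
    and a :: "'o \<Rightarrow> 'o \<Rightarrow> 'o \<Rightarrow> 'm"
    and \<Phi> :: "'o \<Rightarrow> 'm"
    and d :: "'o \<Rightarrow> 'o \<Rightarrow> 'm"
  assumes "hom_braided_category C T F G a \<Phi> d"
  shows "hom_braiding_data.hom_Yang_Baxter C T F G a d"
proof -
  interpret hom_braided_category C T F G a \<Phi> d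
    by (rule assms)
  show ?thesis
    unfolding hom_Yang_Baxter_def
    by (intro ballI) (simp only: yang_baxter_left_eq yang_baxter_right_eq
        exchange_then_braid_in_hom simp_thms)
qed

end
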